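(* Suppose the quadratic Bellman improvement assumption holds: there is $\mu_B>0$ such that $$\delta_s^\pi\le\frac{1}{2\mu_B}\,\bar r_s(\pi)^2$$ for every relevant state $s$ and every relevant policy $\pi$ (one constant $\mu_B$ for all of them). Suppose also that $$\mathcal C_{\mathrm{PL}}=\Big\|\frac{d_\nu^{\pi^\star}}{(d_\mu^\pi)^2}\Big\|_\infty<\infty,$$ where $\pi^\star$ is an optimal policy under the evaluation distribution $\nu$. Then $$J_\nu(\pi^\star)-J_\nu(\pi)\le\frac{1-\gamma}{2\mu_B}\,\mathcal C_{\mathrm{PL}}\,R_{\mathrm{pol}}(\pi)^2.$$ If $G=G(\pi,V,\lambda)\le1$, the right-hand side is at most $$\frac{1-\gamma}{2\mu_B}\,\mathcal C_{\mathrm{PL}}\,C_{\mathrm{stat}}^2\,G.$$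
   Context: $(\mathcal S,\mathcal A,P,r,\gamma)$ is a finite discounted MDP, $0<\gamma<1$, $|r(s,a)|\le R_{\max}$; $\mu$ (training) and $\nu$ (evaluation) are probability distributions on $\mathcal S$. Policies: $\pi\in\Pi=\prod_{s}\Delta(\mathcal A)\subset\mathbb R^{|\mathcal S||\mathcal A|}$, $\pi_s=\pi(\cdot|s)$. $P_\pi(s,s')=\sum_a\pi(a|s)P(s'|s,a)$, $r_\pi(s)=\sum_a\pi(a|s)r(s,a)$, $M_\pi=I-\gamma P_\pi$, $R(\pi,V)=M_\pi V-r_\pi$, $J_\pi(\pi,V)=D_\pi R(\pi,V)$. $V^\pi=M_\pi^{-1}r_\pi$, $Q^\pi(s,a)=r(s,a)+\gamma\sum_{s'}P(s'|s,a)V^\pi(s')$, $J_\nu(\pi)=\nu^{\mathsf T}V^\pi$, $F_\mu(\pi)=-J_\mu(\pi)$. $N_C(x)$ is the normal cone of a convex set $C$ at $x$. Policy stationarity residual: $R_{\mathrm{pol}}(\pi)=\operatorname{dist}(0,\nabla F_\mu(\pi)+N_\Pi(\pi))$. Statewise residual: $\bar r_s(\pi)=\operatorname{dist}(0,-Q^\pi(s,\cdot)+N_{\Delta(\mathcal A)}(\pi_s))$. Bellman improvement: $\delta_s^\pi=(TV^\pi)(s)-V^\pi(s)$ with $T$ the Bellman optimality operator, $(TV)(s)=\max_a\{r(s,a)+\gamma\sum_{s'}P(s'|s,a)V(s')\}$. The improvement assumption is a uniform one over the states and the set of policies under consideration (the "relevant" ones), to which the policy $\pi$ of the conclusion belongs.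 Squared KKT residual (zero regularizer, cost vector $c=-\mu$), for $V,\lambda\in\mathbb R^{|\mathcal S|}$: $G(\pi,V,\lambda)=\operatorname{dist}^2(0,N_\Pi(\pi)+J_\pi(\pi,V)^{\mathsf T}\lambda)+\|M_\pi^{\mathsf T}\lambda-\mu\|^2+\|R(\pi,V)\|^2$. $C_{\mathrm{stat}}<\infty$ is a constant, depending only on the discounted resolvent and bounded model quantities, such that $R_{\mathrm{pol}}(\pi)\le C_{\mathrm{stat}}\sqrt{G(\pi,V,\lambda)}$ whenever $G(\pi,V,\lambda)\le1$. Norms and distances are Euclidean unless indicated. Normalized discounted occupancy: $d_\mu^\pi=(1-\gamma)M_\pi^{-\mathsf T}\mu$. The ratio in $\mathcal C_{\mathrm{PL}}$ is entrywise, with $0/0=0$ and value $+\infty$ when a numerator is positive and its denominator is zero. *)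

theory Defs
  imports "HOL-Analysis.Analysis"
begin

(* States 's and actions 'a are finite types.  A policy is a vector \<pi> :: real^'a^'s with
   \<pi> $ s $ a = \<pi>(a|s); the norm of real^'a^'s is the Euclidean norm of R^(|S||A|).
   The kernel is P s a $ s' = P(s'|s,a).  Everything depending on a policy is defined for all
   vectors \<pi>, not only for those in the policy polytope, so that derivatives in \<pi> make sense. *)

definition prob_simplex :: "(real^'n::finite) set" where
  "prob_simplex = {p. (\<forall>i. 0 \<le> p $ i) \<and> (\<Sum>i\<in>UNIV. p $ i) = 1}"

definition policies :: "(real^'a::finite^'s::finite) set" where
  "policies = {\<pi>. \<forall>s. \<pi> $ s \<in> prob_simplex}"

definition discounted_mdp ::
  "('s::finite \<Rightarrow> 'a::finite \<Rightarrow> real^'s) \<Rightarrow> ('s \<Rightarrow> 'a \<Rightarrow> real) \<Rightarrow> real \<Rightarrow> real \<Rightarrow> bool" where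
  "discounted_mdp P r \<gamma> Rmax \<longleftrightarrow>
     0 < \<gamma> \<and> \<gamma> < 1 \<and> (\<forall>s a. P s a \<in> prob_simplex) \<and> (\<forall>s a. \<bar>r s a\<bar> \<le> Rmax)"

definition policy_kernel ::
  "('s::finite \<Rightarrow> 'a::finite \<Rightarrow> real^'s) \<Rightarrow> real^'a^'s \<Rightarrow> real^'s^'s" where
  "policy_kernel P \<pi> = (\<chi> s s'. \<Sum>a\<in>UNIV. \<pi> $ s $ a * P s a $ s')"

definition policy_reward ::
  "('s::finite \<Rightarrow> 'a::finite \<Rightarrow> real) \<Rightarrow> real^'a^'s \<Rightarrow> real^'s" where
  "policy_reward r \<pi> = (\<chi> s. \<Sum>a\<in>UNIV. \<pi> $ s $ a * r s a)"

definition bellman_matrix ::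
  "('s::finite \<Rightarrow> 'a::finite \<Rightarrow> real^'s) \<Rightarrow> real \<Rightarrow> real^'a^'s \<Rightarrow> real^'s^'s" where
  "bellman_matrix P \<gamma> \<pi> = mat 1 - \<gamma> *\<^sub>R policy_kernel P \<pi>"

definition bellman_residual ::
  "('s::finite \<Rightarrow> 'a::finite \<Rightarrow> real^'s) \<Rightarrow> ('s \<Rightarrow> 'a \<Rightarrow> real) \<Rightarrow> real
     \<Rightarrow> real^'a^'s \<Rightarrow> real^'s \<Rightarrow> real^'s" where
  "bellman_residual P r \<gamma> \<pi> V = bellman_matrix P \<gamma> \<pi> *v V - policy_reward r \<pi>"

definition policy_jacobian ::
  "('s::finite \<Rightarrow> 'a::finite \<Rightarrow> real^'s) \<Rightarrow> ('s \<Rightarrow> 'a \<Rightarrow> real) \<Rightarrow> real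
     \<Rightarrow> real^'a^'s \<Rightarrow> real^'s \<Rightarrow> real^'a^'s \<Rightarrow> real^'s" where
  "policy_jacobian P r \<gamma> \<pi> V =
     frechet_derivative (\<lambda>\<pi>'. bellman_residual P r \<gamma> \<pi>' V) (at \<pi>)"

definition value_fn ::
  "('s::finite \<Rightarrow> 'a::finite \<Rightarrow> real^'s) \<Rightarrow> ('s \<Rightarrow> 'a \<Rightarrow> real) \<Rightarrow> real
     \<Rightarrow> real^'a^'s \<Rightarrow> real^'s" where
  "value_fn P r \<gamma> \<pi> = matrix_inv (bellman_matrix P \<gamma> \<pi>) *v policy_reward r \<pi>"

definition lookahead ::
  "('s::finite \<Rightarrow> 'a::finite \<Rightarrow> real^'s) \<Rightarrow> ('s \<Rightarrow> 'a \<Rightarrow> real) \<Rightarrow> real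
     \<Rightarrow> real^'s \<Rightarrow> 's \<Rightarrow> 'a \<Rightarrow> real" where
  "lookahead P r \<gamma> V s a = r s a + \<gamma> * (\<Sum>s'\<in>UNIV. P s a $ s' * V $ s')"

definition action_value ::
  "('s::finite \<Rightarrow> 'a::finite \<Rightarrow> real^'s) \<Rightarrow> ('s \<Rightarrow> 'a \<Rightarrow> real) \<Rightarrow> real
     \<Rightarrow> real^'a^'s \<Rightarrow> 's \<Rightarrow> real^'a" where
  "action_value P r \<gamma> \<pi> s = (\<chi> a. lookahead P r \<gamma> (value_fn P r \<gamma> \<pi>) s a)"

definition bellman_opt ::
  "('s::finite \<Rightarrow> 'a::finite \<Rightarrow> real^'s) \<Rightarrow> ('s \<Rightarrow> 'a \<Rightarrow> real) \<Rightarrow> real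
     \<Rightarrow> real^'s \<Rightarrow> real^'s" where
  "bellman_opt P r \<gamma> V = (\<chi> s. MAX a. lookahead P r \<gamma> V s a)"

definition bellman_improvement ::
  "('s::finite \<Rightarrow> 'a::finite \<Rightarrow> real^'s) \<Rightarrow> ('s \<Rightarrow> 'a \<Rightarrow> real) \<Rightarrow> real
     \<Rightarrow> real^'a^'s \<Rightarrow> 's \<Rightarrow> real" where
  "bellman_improvement P r \<gamma> \<pi> s =
     bellman_opt P r \<gamma> (value_fn P r \<gamma> \<pi>) $ s - value_fn P r \<gamma> \<pi> $ s"

definition policy_return ::
  "('s::finite \<Rightarrow> 'a::finite \<Rightarrow> real^'s) \<Rightarrow> ('s \<Rightarrow> 'a \<Rightarrow> real) \<Rightarrow> real
     \<Rightarrow> real^'s \<Rightarrow> real^'a^'s \<Rightarrow> real" where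
  "policy_return P r \<gamma> \<nu> \<pi> = \<nu> \<bullet> value_fn P r \<gamma> \<pi>"

definition optimal_policy ::
  "('s::finite \<Rightarrow> 'a::finite \<Rightarrow> real^'s) \<Rightarrow> ('s \<Rightarrow> 'a \<Rightarrow> real) \<Rightarrow> real
     \<Rightarrow> real^'s \<Rightarrow> real^'a^'s \<Rightarrow> bool" where
  "optimal_policy P r \<gamma> \<nu> \<pi>s \<longleftrightarrow>
     \<pi>s \<in> policies \<and>
     (\<forall>\<pi>\<in>policies. policy_return P r \<gamma> \<nu> \<pi> \<le> policy_return P r \<gamma> \<nu> \<pi>s)"

definition occupancy ::
  "('s::finite \<Rightarrow> 'a::finite \<Rightarrow> real^'s) \<Rightarrow> real \<Rightarrow> real^'s \<Rightarrow> real^'a^'s \<Rightarrow> real^'s" where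
  "occupancy P \<gamma> \<mu> \<pi> =
     (1 - \<gamma>) *\<^sub>R (matrix_inv (transpose (bellman_matrix P \<gamma> \<pi>)) *v \<mu>)"

(* Entrywise ratio in the sup norm.  Division of extended reals has exactly the required
   conventions: 0 / 0 = 0, and x / 0 = \<infinity> for x > 0. *)
definition pl_coefficient ::
  "('s::finite \<Rightarrow> 'a::finite \<Rightarrow> real^'s) \<Rightarrow> real \<Rightarrow> real^'s \<Rightarrow> real^'s
     \<Rightarrow> real^'a^'s \<Rightarrow> real^'a^'s \<Rightarrow> ereal" where
  "pl_coefficient P \<gamma> \<mu> \<nu> \<pi>s \<pi> =
     (SUP s. \<bar>ereal (occupancy P \<gamma> \<nu> \<pi>s $ s) / ereal ((occupancy P \<gamma> \<mu> \<pi> $ s)\<^sup>2)\<bar>)"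

definition normal_cone :: "'v::real_inner set \<Rightarrow> 'v \<Rightarrow> 'v set" where
  "normal_cone C x = {v. x \<in> C \<and> (\<forall>y\<in>C. v \<bullet> (y - x) \<le> 0)}"

definition gradient :: "('v::real_inner \<Rightarrow> real) \<Rightarrow> 'v \<Rightarrow> 'v" where
  "gradient f x = (THE D. GDERIV f x :> D)"

(* infdist to the empty set is 0, so the three residuals below are meaningful only for
   \<pi> \<in> policies, where the normal cones contain 0. *)

definition policy_residual ::
  "('s::finite \<Rightarrow> 'a::finite \<Rightarrow> real^'s) \<Rightarrow> ('s \<Rightarrow> 'a \<Rightarrow> real) \<Rightarrow> real
     \<Rightarrow> real^'s \<Rightarrow> real^'a^'s \<Rightarrow> real" where
  "policy_residual P r \<gamma> \<mu> \<pi> =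
     infdist 0 ((\<lambda>v. gradient (\<lambda>\<pi>'. - policy_return P r \<gamma> \<mu> \<pi>') \<pi> + v)
                  ` normal_cone policies \<pi>)"

definition statewise_residual ::
  "('s::finite \<Rightarrow> 'a::finite \<Rightarrow> real^'s) \<Rightarrow> ('s \<Rightarrow> 'a \<Rightarrow> real) \<Rightarrow> real
     \<Rightarrow> real^'a^'s \<Rightarrow> 's \<Rightarrow> real" where
  "statewise_residual P r \<gamma> \<pi> s =
     infdist 0 ((\<lambda>v. - action_value P r \<gamma> \<pi> s + v) ` normal_cone prob_simplex (\<pi> $ s))"

definition kkt_residual ::
  "('s::finite \<Rightarrow> 'a::finite \<Rightarrow> real^'s) \<Rightarrow> ('s \<Rightarrow> 'a \<Rightarrow> real) \<Rightarrow> real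
     \<Rightarrow> real^'s \<Rightarrow> real^'a^'s \<Rightarrow> real^'s \<Rightarrow> real^'s \<Rightarrow> real" where
  "kkt_residual P r \<gamma> \<mu> \<pi> V lam =
     (infdist 0 ((\<lambda>v. v + adjoint (policy_jacobian P r \<gamma> \<pi> V) lam) ` normal_cone policies \<pi>))\<^sup>2
     + (norm (transpose (bellman_matrix P \<gamma> \<pi>) *v lam - \<mu>))\<^sup>2
     + (norm (bellman_residual P r \<gamma> \<pi> V))\<^sup>2"

definition stationarity_constant ::
  "('s::finite \<Rightarrow> 'a::finite \<Rightarrow> real^'s) \<Rightarrow> ('s \<Rightarrow> 'a \<Rightarrow> real) \<Rightarrow> real
     \<Rightarrow> real^'s \<Rightarrow> real \<Rightarrow> bool" where
  "stationarity_constant P r \<gamma> \<mu> C \<longleftrightarrow>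
     (\<forall>\<pi>\<in>policies. \<forall>V lam. kkt_residual P r \<gamma> \<mu> \<pi> V lam \<le> 1 \<longrightarrow>
        policy_residual P r \<gamma> \<mu> \<pi> \<le> C * sqrt (kkt_residual P r \<gamma> \<mu> \<pi> V lam))"

end

theory Submission
  imports Defs
begin

text \<open>By the performance difference identity, the return gap of \<open>\<pi>\<close> is the \<open>\<pi>s\<close>-occupancy average
  of the one-step advantages of \<open>\<pi>s\<close> over \<open>\<pi>\<close>, which are at most the Bellman improvements and hence
  at most a multiple of the squared statewise residuals.  The same identity yields the policy
  gradient, whose block at \<open>s\<close> is \<open>Q\<^sup>\<pi>(s,\<cdot>)\<close> scaled by \<open>d\<^sub>\<mu>(s)/(1-\<gamma>)\<close>; the normal cone of the
  policy polytope is a product of cones, so the squared policy residual dominates the sum of the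
  squared statewise residuals weighted by \<open>(d\<^sub>\<mu>(s)/(1-\<gamma>))\<^sup>2\<close>.  Comparing the two weightings costs
  \<open>C\<^sub>P\<^sub>L\<close>.\<close>

section \<open>Gradients from Caratheodory slopes\<close>

text \<open>The remainder is \<open>(g y - D) \<bullet> (y - x)\<close>, which Cauchy-Schwarz bounds
  by a vanishing multiple of \<open>norm (y - x)\<close>. Since \<open>g\<close> only has to
  converge at \<open>x\<close>, the policy gradient can be found without differentiating a matrix
  inverse.\<close>

lemma GDERIV_caratheodory:
  fixes f :: "'v::real_inner \<Rightarrow> real"
  assumes eq: "\<forall>\<^sub>F y in at x. f y - f x = g y \<bullet> (y - x)"
    and lim: "(g \<longlongrightarrow> D) (at x)"
  shows "GDERIV f x :> D"
  unfolding gderiv_def has_derivative_iff_norm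
proof
  show "bounded_linear (\<lambda>h. h \<bullet> D)"
    by (rule bounded_linear_inner_left)
  have "((\<lambda>y. norm (g y - D)) \<longlongrightarrow> 0) (at x)"
    using lim by (simp add: LIM_zero_iff tendsto_norm_zero_iff)
  moreover have "\<forall>\<^sub>F y in at x. norm (norm (f y - f x - (y - x) \<bullet> D) / norm (y - x)) \<le> norm (g y - D) * 1"
    using eq
  proof (rule eventually_mono)
    fix y assume "f y - f x = g y \<bullet> (y - x)"
    then have "f y - f x - (y - x) \<bullet> D = (g y - D) \<bullet> (y - x)"
      by (simp add: inner_diff_left inner_commute[of D])
    then have "\<bar>f y - f x - (y - x) \<bullet> D\<bar> \<le> norm (g y - D) * norm (y - x)"
      using Cauchy_Schwarz_ineq2 by metis
    then show "norm (norm (f y - f x - (y - x) \<bullet> D) / norm (y - x)) \<le> norm (g y - D) * 1"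
      by (cases "y = x") (simp_all add: divide_le_eq)
  qed
  ultimately show "((\<lambda>y. norm (f y - f x - (y - x) \<bullet> D) / norm (y - x)) \<longlongrightarrow> 0) (at x)"
    by (auto intro: Lim_null_comparison)
qed

lemma GDERIV_imp_gradient:
  assumes "GDERIV f x :> D"
  shows "gradient f x = D"
  unfolding gradient_def
proof (rule the_equality)
  show "GDERIV f x :> D" by fact
next
  fix D' assume "GDERIV f x :> D'"
  then have "(\<lambda>h. h \<bullet> D') = (\<lambda>h. h \<bullet> D)"
    using assms unfolding gderiv_def by (rule has_derivative_unique)
  then show "D' = D"
    by (metis vector_eq_ldot)
qed

section \<open>Continuity of matrix inversion\<close>

lemma tendsto_det [tendsto_intros]:
  fixes A :: "'b \<Rightarrow> real^'n^'n::finite"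
  assumes "(A \<longlongrightarrow> A0) F"
  shows "((\<lambda>x. det (A x)) \<longlongrightarrow> det A0) F"
  unfolding det_def by (intro tendsto_intros assms)

lemma invertible_transpose_iff:
  fixes A :: "real^'n^'n::finite"
  shows "invertible (transpose A) \<longleftrightarrow> invertible A"
  by (simp add: invertible_det_nz det_transpose)

lemma matrix_inv_mult_vector:
  fixes A :: "real^'n^'n::finite"
  assumes "invertible A"
  shows "A *v (matrix_inv A *v b) = b"
    and "matrix_inv A *v (A *v x) = x"
proof -
  have "A ** matrix_inv A = mat 1 \<and> matrix_inv A ** A = mat 1"
    using assms unfolding invertible_def matrix_inv_def by (rule someI_ex)
  then show "A *v (matrix_inv A *v b) = b" and "matrix_inv A *v (A *v x) = x"
    by (simp_all add: matrix_vector_mul_assoc)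
qed

lemma eventually_invertible:
  fixes A :: "'b \<Rightarrow> real^'n^'n::finite"
  assumes "(A \<longlongrightarrow> A0) F" and "invertible A0"
  shows "\<forall>\<^sub>F x in F. invertible (A x)"
  using tendsto_imp_eventually_ne[OF tendsto_det[OF assms(1)]] assms(2)
  by (simp add: invertible_det_nz)

text \<open>By Cramer's rule each entry is a quotient of determinants. These are polynomials in the
  matrix entries, and the denominator tends to \<open>det A0\<close>, which is nonzero.\<close>

lemma tendsto_matrix_inv_mult:
  fixes A :: "'b \<Rightarrow> real^'n^'n::finite"
  assumes lim: "(A \<longlongrightarrow> A0) F" and inv: "invertible A0"
  shows "((\<lambda>x. matrix_inv (A x) *v b) \<longlongrightarrow> matrix_inv A0 *v b) F"
proof -
  define c :: "real^'n^'n \<Rightarrow> real^'n"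
    where "c = (\<lambda>B. \<chi> k. det (\<chi> i j. if j = k then b $ i else B $ i $ j) / det B)"
  have cramer': "matrix_inv B *v b = c B" if "invertible B" for B
    using cramer[of B "matrix_inv B *v b" b] that
    by (simp add: c_def invertible_det_nz matrix_inv_mult_vector)
  have "((\<lambda>x. if j = k then b $ i else A x $ i $ j) \<longlongrightarrow> (if j = k then b $ i else A0 $ i $ j)) F"
    for i j k
    using lim by (cases "j = k") (auto intro: tendsto_vec_nth)
  then have "((\<lambda>x. c (A x)) \<longlongrightarrow> c A0) F"
    unfolding c_def using inv by (intro tendsto_intros lim) (auto simp: invertible_det_nz)
  moreover have "\<forall>\<^sub>F x in F. c (A x) = matrix_inv (A x) *v b"
    using eventually_invertible[OF lim inv] by eventually_elim (simp add: cramer')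
  ultimately show ?thesis
    by (simp add: cramer' inv tendsto_cong)
qed

lemma inner_transpose_matrix_inv:
  fixes A :: "real^'n^'n::finite"
  assumes "invertible A"
  shows "(matrix_inv (transpose A) *v b) \<bullet> (A *v x) = b \<bullet> x"
proof -
  have "(matrix_inv (transpose A) *v b) \<bullet> (A *v x)
      = (transpose A *v (matrix_inv (transpose A) *v b)) \<bullet> x"
    by (simp add: dot_lmul_matrix)
  also have "\<dots> = b \<bullet> x"
    using assms by (simp only: matrix_inv_mult_vector invertible_transpose_iff)
  finally show ?thesis .
qed

section \<open>Positivity of the discounted resolvent\<close>

lemma policies_row: "\<pi> \<in> policies \<Longrightarrow> \<pi> $ s \<in> prob_simplex"
  by (simp add: policies_def)

lemma prob_simplex_average_le:
  assumes "p \<in> prob_simplex" and "\<And>i. f i \<le> m"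
  shows "(\<Sum>i\<in>UNIV. p $ i * f i) \<le> m"
proof -
  have "(\<Sum>i\<in>UNIV. p $ i * f i) \<le> (\<Sum>i\<in>UNIV. p $ i * m)"
    using assms by (intro sum_mono mult_left_mono) (auto simp: prob_simplex_def)
  also have "\<dots> = m"
    using assms(1) by (simp add: prob_simplex_def flip: sum_distrib_right)
  finally show ?thesis .
qed

lemma prob_simplex_average_ge:
  assumes "p \<in> prob_simplex" and "\<And>i. m \<le> f i"
  shows "m \<le> (\<Sum>i\<in>UNIV. p $ i * f i)"
  using prob_simplex_average_le[of p "\<lambda>i. - f i" "- m"] assms by (simp add: sum_negf)

lemma policy_kernel_mult:
  "(policy_kernel P \<pi> *v V) $ s = (\<Sum>a\<in>UNIV. \<pi> $ s $ a * (\<Sum>s'\<in>UNIV. P s a $ s' * V $ s'))"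
proof -
  have "(policy_kernel P \<pi> *v V) $ s = (\<Sum>s'\<in>UNIV. \<Sum>a\<in>UNIV. \<pi> $ s $ a * P s a $ s' * V $ s')"
    by (simp add: policy_kernel_def matrix_vector_mult_def sum_distrib_right)
  also have "\<dots> = (\<Sum>a\<in>UNIV. \<Sum>s'\<in>UNIV. \<pi> $ s $ a * P s a $ s' * V $ s')"
    by (rule sum.swap)
  finally show ?thesis
    by (simp add: sum_distrib_left mult.assoc)
qed

lemma bellman_matrix_mult:
  "bellman_matrix P \<gamma> \<pi> *v V = V - \<gamma> *\<^sub>R (policy_kernel P \<pi> *v V)"
  by (simp add: bellman_matrix_def matrix_vector_mult_diff_rdistrib scaleR_matrix_vector_assoc)

lemma expected_lookahead:
  "(\<Sum>a\<in>UNIV. \<pi> $ s $ a * lookahead P r \<gamma> V s a) = (V - bellman_residual P r \<gamma> \<pi> V) $ s"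
  by (simp add: bellman_residual_def bellman_matrix_mult policy_kernel_mult policy_reward_def
      lookahead_def distrib_left sum.distrib sum_distrib_left mult.left_commute)

text \<open>A discrete minimum principle: at a state where \<open>V\<close> attains its minimum
  \<open>m\<close>, the kernel average of \<open>V\<close> is at least \<open>m\<close>, so the
  hypothesis there gives \<open>\<gamma> * m \<le> m\<close>, and \<gamma> < 1 forces
  \<open>m\<close> to be nonnegative.\<close>

lemma bellman_matrix_nonneg_imp_nonneg:
  assumes "discounted_mdp P r \<gamma> Rmax" and "\<pi> \<in> policies"
    and nonneg: "\<And>s. 0 \<le> (bellman_matrix P \<gamma> \<pi> *v V) $ s"
  shows "0 \<le> V $ s"
proof -
  define m where "m = Min (range (($) V))"
  have m_le: "m \<le> V $ t" for t
    by (simp add: m_def)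
  have "m \<in> range (($) V)"
    unfolding m_def by (rule Min_in) auto
  then obtain t where t: "m = V $ t"
    by blast
  have "P t a \<in> prob_simplex" for a
    using assms(1) by (simp add: discounted_mdp_def)
  then have "m \<le> (policy_kernel P \<pi> *v V) $ t"
    unfolding policy_kernel_mult
    by (intro prob_simplex_average_ge policies_row assms(2) m_le)
  then have "\<gamma> * m \<le> \<gamma> * (policy_kernel P \<pi> *v V) $ t"
    using assms(1) by (simp add: discounted_mdp_def)
  also have "\<dots> \<le> m"
    using nonneg[of t] by (simp add: bellman_matrix_mult t)
  finally have "0 \<le> (1 - \<gamma>) * m"
    by (simp add: algebra_simps)
  then have "0 \<le> m"
    using assms(1) by (simp add: discounted_mdp_def zero_le_mult_iff)
  then show ?thesis
    using m_le order_trans by blast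
qed

text \<open>The minimum principle, applied to a kernel vector and to its negative, makes the kernel
  trivial. For a square matrix this suffices.\<close>

lemma invertible_bellman_matrix:
  assumes "discounted_mdp P r \<gamma> Rmax" and "\<pi> \<in> policies"
  shows "invertible (bellman_matrix P \<gamma> \<pi>)"
proof -
  have "V = 0" if "bellman_matrix P \<gamma> \<pi> *v V = 0" for V
  proof -
    have "bellman_matrix P \<gamma> \<pi> *v (- V) = 0"
      using that matrix_vector_mult_diff_distrib[of "bellman_matrix P \<gamma> \<pi>" 0 V] by simp
    then have "0 \<le> (- V) $ s" for s
      by (simp add: bellman_matrix_nonneg_imp_nonneg[OF assms] del: vector_uminus_component)
    moreover have "0 \<le> V $ s" for s
      by (rule bellman_matrix_nonneg_imp_nonneg[OF assms]) (simp add: that)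
    ultimately show ?thesis
      by (simp add: vec_eq_iff order_antisym)
  qed
  then show ?thesis
    by (auto simp: invertible_left_inverse matrix_left_invertible_ker)
qed

lemma occupancy_nonneg:
  assumes "discounted_mdp P r \<gamma> Rmax" and "\<pi> \<in> policies" and "\<mu> \<in> prob_simplex"
  shows "0 \<le> occupancy P \<gamma> \<mu> \<pi> $ s"
proof -
  define M where "M = bellman_matrix P \<gamma> \<pi>"
  have inv: "invertible M"
    unfolding M_def by (rule invertible_bellman_matrix[OF assms(1,2)])
  \<comment> \<open>Duality: pairing \<mu> with column \<open>s\<close> of the inverse gives entry
    \<open>s\<close> of the unnormalized occupancy. That column is nonnegative by the minimum
    principle.\<close>
  define x where "x = matrix_inv M *v axis s 1"
  have Mx: "M *v x = axis s 1"
    by (simp add: x_def matrix_inv_mult_vector inv)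
  have "0 \<le> x $ t" for t
    by (rule bellman_matrix_nonneg_imp_nonneg[OF assms(1,2)])
      (use Mx in \<open>simp add: M_def axis_def\<close>)
  moreover have "0 \<le> \<mu> $ t" for t
    using assms(3) by (simp add: prob_simplex_def)
  ultimately have "0 \<le> \<mu> \<bullet> x"
    by (auto simp: inner_vec_def intro!: sum_nonneg)
  also have "\<mu> \<bullet> x = (matrix_inv (transpose M) *v \<mu>) $ s"
    using inner_transpose_matrix_inv[OF inv, of \<mu> x] by (simp add: Mx inner_axis)
  finally show ?thesis
    using assms(1) by (simp add: occupancy_def M_def discounted_mdp_def)
qed

section \<open>Performance difference and policy gradient\<close>

text \<open>Applying the Bellman matrix to \<open>value_fn P r \<gamma> \<pi> - V\<close> leaves
  minus the Bellman residual of \<open>V\<close>, and the transposed inverse moves onto \<nu> as the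
  occupancy. Assuming invertibility instead of membership in \<open>policies\<close> covers the
  vectors off the polytope that a gradient involves; \<open>V\<close> is arbitrary so that the value
  of another policy can be inserted.\<close>

lemma performance_difference:
  assumes "\<gamma> \<noteq> 1" and "invertible (bellman_matrix P \<gamma> \<pi>)"
  shows "policy_return P r \<gamma> \<nu> \<pi> - \<nu> \<bullet> V
    = (\<Sum>s\<in>UNIV. occupancy P \<gamma> \<nu> \<pi> $ s / (1 - \<gamma>)
         * ((\<Sum>a\<in>UNIV. \<pi> $ s $ a * lookahead P r \<gamma> V s a) - V $ s))"
proof -
  define M where "M = bellman_matrix P \<gamma> \<pi>"
  define w where "w = matrix_inv (transpose M) *v \<nu>"
  have "policy_return P r \<gamma> \<nu> \<pi> - \<nu> \<bullet> V = \<nu> \<bullet> (value_fn P r \<gamma> \<pi> - V)"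
    by (simp add: policy_return_def inner_diff_right)
  also have "\<dots> = w \<bullet> (M *v (value_fn P r \<gamma> \<pi> - V))"
    using assms(2) by (simp only: w_def M_def inner_transpose_matrix_inv)
  also have "M *v (value_fn P r \<gamma> \<pi> - V) = - bellman_residual P r \<gamma> \<pi> V"
    using assms(2)
    by (simp add: value_fn_def bellman_residual_def matrix_vector_mult_diff_distrib
        matrix_inv_mult_vector M_def)
  also have "w \<bullet> (- bellman_residual P r \<gamma> \<pi> V) = (\<Sum>s\<in>UNIV. occupancy P \<gamma> \<nu> \<pi> $ s / (1 - \<gamma>)
         * ((\<Sum>a\<in>UNIV. \<pi> $ s $ a * lookahead P r \<gamma> V s a) - V $ s))"
    unfolding expected_lookahead using assms(1)
    by (simp add: inner_vec_def w_def M_def occupancy_def sum_negf)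
  finally show ?thesis .
qed

lemma expected_action_value:
  assumes "invertible (bellman_matrix P \<gamma> \<pi>)"
  shows "(\<Sum>a\<in>UNIV. \<pi> $ s $ a * lookahead P r \<gamma> (value_fn P r \<gamma> \<pi>) s a) = value_fn P r \<gamma> \<pi> $ s"
  unfolding expected_lookahead using assms
  by (simp add: bellman_residual_def value_fn_def matrix_inv_mult_vector)

lemma tendsto_bellman_matrix:
  "(bellman_matrix P \<gamma> \<longlongrightarrow> bellman_matrix P \<gamma> \<pi>) (at \<pi>)"
  unfolding bellman_matrix_def policy_kernel_def by (intro tendsto_intros)

lemma tendsto_transpose [tendsto_intros]:
  fixes A :: "'b \<Rightarrow> real^'n^'m"
  assumes "(A \<longlongrightarrow> A0) F"
  shows "((\<lambda>x. transpose (A x)) \<longlongrightarrow> transpose A0) F"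
  unfolding transpose_def by (intro tendsto_intros assms)

lemma tendsto_occupancy:
  assumes "invertible (bellman_matrix P \<gamma> \<pi>)"
  shows "(occupancy P \<gamma> \<mu> \<longlongrightarrow> occupancy P \<gamma> \<mu> \<pi>) (at \<pi>)"
  unfolding occupancy_def using assms
  by (intro tendsto_intros tendsto_matrix_inv_mult tendsto_bellman_matrix)
    (simp add: invertible_transpose_iff)

text \<open>The performance difference of \<pi>' against the value of \<pi> is an exact slope
  formula: the action values stay those of \<pi>, and only the occupancy depends on \<pi>',
  continuously.\<close>

theorem policy_gradient:
  assumes "\<gamma> \<noteq> 1" and inv: "invertible (bellman_matrix P \<gamma> \<pi>)"
  shows "GDERIV (policy_return P r \<gamma> \<mu>) \<pi> :>
    (\<chi> s. (occupancy P \<gamma> \<mu> \<pi> $ s / (1 - \<gamma>)) *\<^sub>R action_value P r \<gamma> \<pi> s)"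
proof (rule GDERIV_caratheodory)
  let ?g = "\<lambda>\<pi>'. \<chi> s. (occupancy P \<gamma> \<mu> \<pi>' $ s / (1 - \<gamma>)) *\<^sub>R action_value P r \<gamma> \<pi> s"
  show "(?g \<longlongrightarrow> ?g \<pi>) (at \<pi>)"
    using \<open>\<gamma> \<noteq> 1\<close> by (intro tendsto_intros tendsto_occupancy inv) simp
  show "\<forall>\<^sub>F \<pi>' in at \<pi>. policy_return P r \<gamma> \<mu> \<pi>' - policy_return P r \<gamma> \<mu> \<pi> = ?g \<pi>' \<bullet> (\<pi>' - \<pi>)"
    \<comment> \<open>Here \<pi>' ranges over all nearby vectors, so invertibility comes from
      openness and not from stochasticity.\<close>
    using eventually_invertible[OF tendsto_bellman_matrix inv]
  proof (rule eventually_mono)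
    fix \<pi>' assume inv': "invertible (bellman_matrix P \<gamma> \<pi>')"
    let ?Q = "lookahead P r \<gamma> (value_fn P r \<gamma> \<pi>)"
    have "(\<Sum>a\<in>UNIV. \<pi>' $ s $ a * ?Q s a) - value_fn P r \<gamma> \<pi> $ s
        = action_value P r \<gamma> \<pi> s \<bullet> (\<pi>' - \<pi>) $ s" for s
      using expected_action_value[OF inv, where r = r and s = s]
      by (simp add: action_value_def inner_vec_def algebra_simps sum_subtractf)
    then show "policy_return P r \<gamma> \<mu> \<pi>' - policy_return P r \<gamma> \<mu> \<pi> = ?g \<pi>' \<bullet> (\<pi>' - \<pi>)"
      unfolding policy_return_def[of P r \<gamma> \<mu> \<pi>] performance_difference[OF \<open>\<gamma> \<noteq> 1\<close> inv']
      by (simp add: inner_vec_def[of "?g \<pi>'"])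
  qed
qed

section \<open>Product normal cones and stationarity residuals\<close>

lemma normal_cone_policies_row:
  assumes "v \<in> normal_cone policies \<pi>"
  shows "v $ s \<in> normal_cone prob_simplex (\<pi> $ s)"
proof -
  have pol: "\<pi> \<in> policies"
    using assms by (simp add: normal_cone_def)
  have "v $ s \<bullet> (p - \<pi> $ s) \<le> 0" if "p \<in> prob_simplex" for p
  proof -
    \<comment> \<open>Changing row \<open>s\<close> alone reduces the normal cone inequality to that
      row.\<close>
    define \<pi>' where "\<pi>' = (\<chi> t. if t = s then p else \<pi> $ t)"
    have "\<pi>' \<in> policies"
      using pol that by (simp add: policies_def \<pi>'_def)
    then have "v \<bullet> (\<pi>' - \<pi>) \<le> 0"
      using assms by (simp add: normal_cone_def)
    also have "v \<bullet> (\<pi>' - \<pi>) = (\<Sum>t\<in>UNIV. if t = s then v $ s \<bullet> (p - \<pi> $ s) else 0)"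
      unfolding inner_vec_def[of v] \<pi>'_def by (rule sum.cong) auto
    finally show ?thesis
      by simp
  qed
  then show ?thesis
    using policies_row[OF pol] by (simp add: normal_cone_def)
qed

lemma normal_cone_scaleR:
  assumes "v \<in> normal_cone C x" and "0 \<le> c"
  shows "c *\<^sub>R v \<in> normal_cone C x"
  using assms by (auto simp: normal_cone_def mult_nonneg_nonpos)

text \<open>A cone is invariant under positive scaling: for positive \<open>w\<close>, the vector
  \<open>(1 / w) *\<^sub>R v\<close> competes in the infimum defining the statewise residual. For
  \<open>w = 0\<close> the left side vanishes.\<close>

lemma statewise_residual_scaled_le:
  assumes "v \<in> normal_cone prob_simplex (\<pi> $ s)" and "0 \<le> w"
  shows "w * statewise_residual P r \<gamma> \<pi> s \<le> norm (- (w *\<^sub>R action_value P r \<gamma> \<pi> s) + v)"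
proof (cases "w = 0")
  case False
  then have "w > 0"
    using assms(2) by simp
  then have "(1 / w) *\<^sub>R v \<in> normal_cone prob_simplex (\<pi> $ s)"
    using assms(1) by (intro normal_cone_scaleR) simp_all
  then have "statewise_residual P r \<gamma> \<pi> s
      \<le> dist 0 (- action_value P r \<gamma> \<pi> s + (1 / w) *\<^sub>R v)"
    unfolding statewise_residual_def by (intro infdist_le imageI)
  then have "w * statewise_residual P r \<gamma> \<pi> s
      \<le> w * norm (- action_value P r \<gamma> \<pi> s + (1 / w) *\<^sub>R v)"
    using \<open>w > 0\<close> by simp
  also have "\<dots> = norm (w *\<^sub>R (- action_value P r \<gamma> \<pi> s + (1 / w) *\<^sub>R v))"
    using \<open>w > 0\<close> by simp
  also have "w *\<^sub>R (- action_value P r \<gamma> \<pi> s + (1 / w) *\<^sub>R v)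
      = - (w *\<^sub>R action_value P r \<gamma> \<pi> s) + v"
    using \<open>w > 0\<close> by (simp add: scaleR_diff_right scaleR_add_right)
  finally show ?thesis .
qed simp

lemma norm_power2_rows:
  fixes x :: "(real^'a)^'s"
  shows "(norm x)\<^sup>2 = (\<Sum>s\<in>UNIV. (norm (x $ s))\<^sup>2)"
  by (simp add: norm_vec_def L2_set_def sum_nonneg)

lemma statewise_residuals_le_policy_residual:
  assumes mdp: "discounted_mdp P r \<gamma> Rmax" and pol: "\<pi> \<in> policies" and "\<mu> \<in> prob_simplex"
  shows "(\<Sum>s\<in>UNIV. (occupancy P \<gamma> \<mu> \<pi> $ s / (1 - \<gamma>) * statewise_residual P r \<gamma> \<pi> s)\<^sup>2)
    \<le> (policy_residual P r \<gamma> \<mu> \<pi>)\<^sup>2" (is "?S \<le> _")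
proof -
  define w where "w = (\<lambda>s. occupancy P \<gamma> \<mu> \<pi> $ s / (1 - \<gamma>))"
  define N where "N = normal_cone policies \<pi>"
  have "\<gamma> < 1"
    using mdp by (simp add: discounted_mdp_def)
  have w: "0 \<le> w s" for s
    using occupancy_nonneg[OF assms] \<open>\<gamma> < 1\<close> by (simp add: w_def)
  have grad: "gradient (\<lambda>\<pi>'. - policy_return P r \<gamma> \<mu> \<pi>') \<pi>
      = - (\<chi> s. w s *\<^sub>R action_value P r \<gamma> \<pi> s)" (is "_ = ?g")
    unfolding w_def using \<open>\<gamma> < 1\<close>
    by (intro GDERIV_imp_gradient GDERIV_minus policy_gradient
        invertible_bellman_matrix[OF mdp pol]) simp
  \<comment> \<open>One bound for all normal vectors \<open>v\<close> passes to the infimum, so no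
    minimizer has to be chosen.\<close>
  have "sqrt ?S \<le> norm (?g + v)" if "v \<in> N" for v
  proof -
    have "?S \<le> (\<Sum>s\<in>UNIV. (norm ((?g + v) $ s))\<^sup>2)"
    proof (intro sum_mono power_mono)
      fix s
      show "occupancy P \<gamma> \<mu> \<pi> $ s / (1 - \<gamma>) * statewise_residual P r \<gamma> \<pi> s \<le> norm ((?g + v) $ s)"
        using statewise_residual_scaled_le[OF normal_cone_policies_row w] that
        by (simp add: N_def w_def)
      show "0 \<le> occupancy P \<gamma> \<mu> \<pi> $ s / (1 - \<gamma>) * statewise_residual P r \<gamma> \<pi> s"
        unfolding statewise_residual_def
        using w[of s] by (intro mult_nonneg_nonneg infdist_nonneg) (simp add: w_def)
    qed
    then show ?thesis
      unfolding norm_power2_rows[symmetric] by (rule real_le_lsqrt[rotated]) simp_all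
  qed
  \<comment> \<open>The zero vector is normal. This excludes the default value 0 of
    \<open>infdist\<close> on the empty set.\<close>
  moreover have "N \<noteq> {}"
    using pol by (auto simp: N_def normal_cone_def intro: exI[of _ 0])
  ultimately have "sqrt ?S \<le> policy_residual P r \<gamma> \<mu> \<pi>"
    unfolding policy_residual_def grad N_def[symmetric]
    by (auto simp: infdist_notempty intro!: cINF_greatest)
  then show ?thesis
    by (rule sqrt_le_D)
qed

section \<open>Change of occupancy and the final bounds\<close>

text \<open>Turns the extended-real supremum into a real inequality at each state. Finiteness
  matters because \<open>real_of_ereal\<close> sends infinity to 0.\<close>

lemma pl_coefficient_bound:
  assumes fin: "pl_coefficient P \<gamma> \<mu> \<nu> \<pi>s \<pi> < \<infinity>"
    and nonneg: "\<And>s. 0 \<le> occupancy P \<gamma> \<nu> \<pi>s $ s"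
  shows "0 \<le> real_of_ereal (pl_coefficient P \<gamma> \<mu> \<nu> \<pi>s \<pi>)"
    and "occupancy P \<gamma> \<nu> \<pi>s $ s
      \<le> real_of_ereal (pl_coefficient P \<gamma> \<mu> \<nu> \<pi>s \<pi>) * (occupancy P \<gamma> \<mu> \<pi> $ s)\<^sup>2"
proof -
  let ?C = "pl_coefficient P \<gamma> \<mu> \<nu> \<pi>s \<pi>"
  have le: "\<bar>ereal (occupancy P \<gamma> \<nu> \<pi>s $ t) / ereal ((occupancy P \<gamma> \<mu> \<pi> $ t)\<^sup>2)\<bar> \<le> ?C" for t
    unfolding pl_coefficient_def by (rule SUP_upper) simp
  have "0 \<le> ?C"
    using order_trans[OF abs_ereal_pos le] .
  then obtain c where c: "?C = ereal c" "0 \<le> c"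
    using fin by (cases ?C) auto
  then show "0 \<le> real_of_ereal ?C"
    by simp
  show "occupancy P \<gamma> \<nu> \<pi>s $ s \<le> real_of_ereal ?C * (occupancy P \<gamma> \<mu> \<pi> $ s)\<^sup>2"
  proof (cases "occupancy P \<gamma> \<mu> \<pi> $ s = 0")
    \<comment> \<open>A positive numerator over this zero denominator would make the ratio, and
      hence the supremum, infinite.\<close>
    case True
    then have "\<not> 0 < occupancy P \<gamma> \<nu> \<pi>s $ s"
      using le[of s] by (auto simp: c(1) divide_ereal_def)
    then show ?thesis
      using True by simp
  next
    case False
    then show ?thesis
      using le[of s] nonneg[of s] by (simp add: c(1) divide_le_eq)
  qed
qed

lemma expected_lookahead_le_bellman_opt:
  assumes "\<pi> \<in> policies"
  shows "(\<Sum>a\<in>UNIV. \<pi> $ s $ a * lookahead P r \<gamma> V s a) \<le> bellman_opt P r \<gamma> V $ s"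
  using assms by (intro prob_simplex_average_le policies_row) (simp_all add: bellman_opt_def)

theorem theorem6p8:
  fixes P :: "'s::finite \<Rightarrow> 'a::finite \<Rightarrow> real^'s"
    and r :: "'s \<Rightarrow> 'a \<Rightarrow> real"
    and \<gamma> Rmax \<mu>B :: real
    and \<mu> \<nu> :: "real^'s"
    and Rel :: "(real^'a^'s) set"
    and \<pi> \<pi>s :: "real^'a^'s"
  assumes "discounted_mdp P r \<gamma> Rmax"
    and "\<mu> \<in> prob_simplex" and "\<nu> \<in> prob_simplex"
    and "Rel \<subseteq> policies" and "\<pi> \<in> Rel"
    and "\<mu>B > 0"
    and "\<forall>s. \<forall>\<pi>'\<in>Rel. bellman_improvement P r \<gamma> \<pi>' s
            \<le> 1 / (2 * \<mu>B) * (statewise_residual P r \<gamma> \<pi>' s)\<^sup>2"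
    and "optimal_policy P r \<gamma> \<nu> \<pi>s"
    and "pl_coefficient P \<gamma> \<mu> \<nu> \<pi>s \<pi> < \<infinity>"
  shows "policy_return P r \<gamma> \<nu> \<pi>s - policy_return P r \<gamma> \<nu> \<pi>
           \<le> (1 - \<gamma>) / (2 * \<mu>B) * real_of_ereal (pl_coefficient P \<gamma> \<mu> \<nu> \<pi>s \<pi>)
               * (policy_residual P r \<gamma> \<mu> \<pi>)\<^sup>2
       \<and> (\<forall>Cstat V lam.
            stationarity_constant P r \<gamma> \<mu> Cstat \<longrightarrow> kkt_residual P r \<gamma> \<mu> \<pi> V lam \<le> 1 \<longrightarrow>
            (1 - \<gamma>) / (2 * \<mu>B) * real_of_ereal (pl_coefficient P \<gamma> \<mu> \<nu> \<pi>s \<pi>)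
               * (policy_residual P r \<gamma> \<mu> \<pi>)\<^sup>2
            \<le> (1 - \<gamma>) / (2 * \<mu>B) * real_of_ereal (pl_coefficient P \<gamma> \<mu> \<nu> \<pi>s \<pi>)
               * Cstat\<^sup>2 * kkt_residual P r \<gamma> \<mu> \<pi> V lam)"
proof -
  let ?C = "real_of_ereal (pl_coefficient P \<gamma> \<mu> \<nu> \<pi>s \<pi>)"
  let ?R = "policy_residual P r \<gamma> \<mu> \<pi>"
  let ?d\<nu> = "\<lambda>s. occupancy P \<gamma> \<nu> \<pi>s $ s"
  let ?d\<mu> = "\<lambda>s. occupancy P \<gamma> \<mu> \<pi> $ s"
  let ?\<rho> = "statewise_residual P r \<gamma> \<pi>"
  have \<gamma>: "\<gamma> < 1"
    using assms(1) by (simp add: discounted_mdp_def)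
  have pol: "\<pi> \<in> policies" and pols: "\<pi>s \<in> policies"
    using assms(4,5,8) by (auto simp: optimal_policy_def)
  have d\<nu>: "0 \<le> ?d\<nu> s" for s
    by (rule occupancy_nonneg[OF assms(1) pols assms(3)])
  note C = pl_coefficient_bound[OF assms(9) d\<nu>]
  \<comment> \<open>Performance difference for \<open>\<pi>s\<close> with \<open>V\<close> the value
    of \<pi>; the maximum over actions dominates the average under \<open>\<pi>s\<close>.\<close>
  have "policy_return P r \<gamma> \<nu> \<pi>s - policy_return P r \<gamma> \<nu> \<pi>
      \<le> (\<Sum>s\<in>UNIV. ?d\<nu> s / (1 - \<gamma>) * bellman_improvement P r \<gamma> \<pi> s)"
    unfolding policy_return_def[of P r \<gamma> \<nu> \<pi>] bellman_improvement_def
    using \<gamma> d\<nu> performance_difference[OF _ invertible_bellman_matrix[OF assms(1) pols],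
        of r \<nu> "value_fn P r \<gamma> \<pi>"]
    by (auto intro!: sum_mono divide_right_mono mult_left_mono
        expected_lookahead_le_bellman_opt[OF pols])
  \<comment> \<open>The left side carries one factor \<open>1 / (1 - \<gamma>)\<close>, the squared
    gradient weight carries two; the prefactor \<open>1 - \<gamma>\<close> makes up the
    difference.\<close>
  also have "\<dots> \<le> (\<Sum>s\<in>UNIV. (1 - \<gamma>) / (2 * \<mu>B) * ?C * (?d\<mu> s / (1 - \<gamma>) * ?\<rho> s)\<^sup>2)"
  proof (rule sum_mono)
    fix s
    have "?d\<nu> s / (1 - \<gamma>) * bellman_improvement P r \<gamma> \<pi> s
        \<le> ?d\<nu> s / (1 - \<gamma>) * (1 / (2 * \<mu>B) * (?\<rho> s)\<^sup>2)"
      using assms(5,7) \<gamma> d\<nu> by (intro mult_left_mono) auto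
    also have "\<dots> \<le> ?C * (?d\<mu> s)\<^sup>2 / (1 - \<gamma>) * (1 / (2 * \<mu>B) * (?\<rho> s)\<^sup>2)"
      using C(2)[of s] \<gamma> \<open>\<mu>B > 0\<close> by (intro mult_right_mono divide_right_mono) auto
    also have "\<dots> = (1 - \<gamma>) / (2 * \<mu>B) * ?C * (?d\<mu> s / (1 - \<gamma>) * ?\<rho> s)\<^sup>2"
      using \<gamma> by (simp add: power2_eq_square mult_ac)
    finally show "?d\<nu> s / (1 - \<gamma>) * bellman_improvement P r \<gamma> \<pi> s
        \<le> (1 - \<gamma>) / (2 * \<mu>B) * ?C * (?d\<mu> s / (1 - \<gamma>) * ?\<rho> s)\<^sup>2" .
  qed
  also have "\<dots> \<le> (1 - \<gamma>) / (2 * \<mu>B) * ?C * ?R\<^sup>2"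
    unfolding sum_distrib_left[symmetric]
    using statewise_residuals_le_policy_residual[OF assms(1) pol assms(2)] C(1) \<gamma> \<open>\<mu>B > 0\<close>
    by (intro mult_left_mono) auto
  finally have gap: "policy_return P r \<gamma> \<nu> \<pi>s - policy_return P r \<gamma> \<nu> \<pi>
      \<le> (1 - \<gamma>) / (2 * \<mu>B) * ?C * ?R\<^sup>2" .
  have "(1 - \<gamma>) / (2 * \<mu>B) * ?C * ?R\<^sup>2
      \<le> (1 - \<gamma>) / (2 * \<mu>B) * ?C * Cstat\<^sup>2 * kkt_residual P r \<gamma> \<mu> \<pi> V lam"
    if "stationarity_constant P r \<gamma> \<mu> Cstat" and "kkt_residual P r \<gamma> \<mu> \<pi> V lam \<le> 1"
    for Cstat V lam
  proof -
    let ?G = "kkt_residual P r \<gamma> \<mu> \<pi> V lam"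
    \<comment> \<open>Squaring preserves the inequality because \<open>?R\<close> is a distance,
      hence nonnegative. The square root then cancels because \<open>?G\<close> is a sum of
      squares.\<close>
    have "?R\<^sup>2 \<le> (Cstat * sqrt ?G)\<^sup>2"
      using that pol
      by (intro power_mono) (auto simp: stationarity_constant_def policy_residual_def infdist_nonneg)
    also have "\<dots> = Cstat\<^sup>2 * ?G"
      by (simp add: power_mult_distrib kkt_residual_def)
    finally show ?thesis
      unfolding mult.assoc[of _ "Cstat\<^sup>2"] using C(1) \<gamma> \<open>\<mu>B > 0\<close>
      by (intro mult_left_mono) auto
  qed
  with gap show ?thesis
    by blast
qed

end
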